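(* If Matiyasevich's conjecture (stated in the context) is true, then for every computable function $f:\mathbb{N}\setminus\{0\}\to\mathbb{N}$ there is a positive integer $m(f)$ such that for each integer $n\ge m(f)$ there exists a system $S\subseteq E_n$ which has only finitely many solutions in integers $x_1,\ldots,x_n$ and each integer tuple $(x_1,\ldots,x_n)$ that solves $S$ satisfies $x_1=f(n)+1$.
   Context: $\mathbb{N}$ denotes the set of non-negative integers. For a positive integer $n$, let $E_n=\{x_i=1,\ x_i+x_j=x_k,\ x_i\cdot x_j=x_k:\ i,j,k\in\{1,\ldots,n\}\}$ be the set of all formal equations of these forms in the variables $x_1,\ldots,x_n$ (indices may coincide). A tuple solves a system $S\subseteq E_n$ if it satisfies every equation in $S$. Matiyasevich's conjecture: every recursively enumerable set $\mathcal{M}\subseteq\mathbb{N}^n$ has a finite-fold Diophantine representation, i.e. there are $m$ and a polynomial $W$ with integer coefficients in $n+m$ variables such that for all $(a_1,\ldots,a_n)\in\mathbb{N}^n$: $(a_1,\ldots,a_n)\in\mathcal{M}$ if and only if there exist $x_1,\ldots,x_m\in\mathbb{N}$ with $W(a_1,\ldots,a_n,x_1,\ldots,x_m)=0$; and for any $a_1,\ldots,a_n\in\mathbb{N}$ the equation $W(a_1,\ldots,a_n,x_1,\ldots,x_m)=0$ has at most finitely many solutions $(x_1,\ldots,x_m)\in\mathbb{N}^m$. *)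

theory Defs
  imports Main "HOL-Library.Poly_Mapping" "HOL-Library.FuncSet"
begin

text \<open>
  Programs for partial recursive functions.  Arities are not recorded in the syntax: a program
  denotes, for each \<open>k\<close>, a partial recursive function of \<open>k\<close> arguments, namely the restriction of
  the evaluation relation to argument lists of length \<open>k\<close>.
\<close>

datatype recf =
    Zero
  | Succ
  | Proj nat
  | Comp recf "recf list"
  | Prec recf recf
  | Mu recf

inductive computes :: "recf \<Rightarrow> nat list \<Rightarrow> nat \<Rightarrow> bool" where
  zero: "computes Zero xs 0"
| succ: "computes Succ [x] (Suc x)"
| proj: "i < length xs \<Longrightarrow> computes (Proj i) xs (xs ! i)"
| comp: "list_all2 (\<lambda>g y. computes g xs y) gs ys \<Longrightarrow> computes f ys z \<Longrightarrow> computes (Comp f gs) xs z"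
| prec_0: "computes g xs y \<Longrightarrow> computes (Prec g h) (0 # xs) y"
| prec_Suc: "computes (Prec g h) (k # xs) r \<Longrightarrow> computes h (k # r # xs) y
    \<Longrightarrow> computes (Prec g h) (Suc k # xs) y"
| mu: "computes f (y # xs) 0 \<Longrightarrow> (\<And>z. z < y \<Longrightarrow> \<exists>v. computes f (z # xs) (Suc v))
    \<Longrightarrow> computes (Mu f) xs y"

inductive_cases computes_ZeroE: "computes Zero xs y"
inductive_cases computes_SuccE: "computes Succ xs y"
inductive_cases computes_ProjE: "computes (Proj i) xs y"
inductive_cases computes_CompE: "computes (Comp f gs) xs y"
inductive_cases computes_Prec_0E: "computes (Prec g h) (0 # xs) y"
inductive_cases computes_Prec_SucE: "computes (Prec g h) (Suc k # xs) y"
inductive_cases computes_MuE: "computes (Mu f) xs y"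

lemma computes_deterministic:
  "computes p xs y \<Longrightarrow> computes p xs y' \<Longrightarrow> y = y'"
proof (induction arbitrary: y' rule: computes.induct)
  case (zero xs)
  then show ?case by (rule computes_ZeroE) simp
next
  case (succ x)
  then show ?case by (rule computes_SuccE) simp
next
  case (proj i xs)
  from proj.prems show ?case by (rule computes_ProjE) simp
next
  case (comp xs gs ys f z)
  from comp.prems obtain ys' where
    ys': "list_all2 (\<lambda>g y. computes g xs y) gs ys'" "computes f ys' y'"
    by (rule computes_CompE)
  have "ys = ys'"
    using comp.IH(1) ys'(1) by (simp add: list_all2_conv_all_nth list_eq_iff_nth_eq)
  then show ?case using comp.IH(2) ys'(2) by simp
next
  case (prec_0 g xs y h)
  from prec_0.prems show ?case by (rule computes_Prec_0E) (rule prec_0.IH)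
next
  case (prec_Suc g h k xs r y)
  from prec_Suc.prems obtain r' where
    "computes (Prec g h) (k # xs) r'" "computes h (k # r' # xs) y'"
    by (rule computes_Prec_SucE)
  then show ?case using prec_Suc.IH by metis
next
  case (mu f y xs)
  from mu.prems obtain y': "computes f (y' # xs) 0"
      "\<And>z. z < y' \<Longrightarrow> \<exists>v. computes f (z # xs) (Suc v)"
    by (rule computes_MuE) blast
  show ?case
  proof (rule linorder_cases[of y y'])
    assume "y < y'"
    then obtain v where "computes f (y # xs) (Suc v)" using y'(2) by blast
    from mu.IH(1)[OF this] show ?thesis by simp
  next
    assume "y' < y"
    then obtain v where "\<And>w. computes f (y' # xs) w \<Longrightarrow> Suc v = w" using mu.IH(2) by blast
    from this[OF y'(1)] show ?thesis by simp
  qed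
qed

text \<open>A function on the positive integers; its value at \<open>0\<close> is irrelevant.\<close>

definition computable_pos :: "(nat \<Rightarrow> nat) \<Rightarrow> bool" where
  "computable_pos f \<longleftrightarrow> (\<exists>p. \<forall>n\<ge>1. computes p [n] (f n))"

text \<open>Elements of \<open>\<nat>\<^sup>n\<close> are lists of length \<open>n\<close>; an r.e. set is the domain of a partial recursive function.\<close>

definition recursively_enumerable :: "nat \<Rightarrow> nat list set \<Rightarrow> bool" where
  "recursively_enumerable n M \<longleftrightarrow>
     M \<subseteq> {as. length as = n} \<and>
     (\<exists>p. \<forall>as. length as = n \<longrightarrow> (as \<in> M \<longleftrightarrow> (\<exists>y. computes p as y)))"

text \<open>
  Integer polynomials in variables indexed by natural numbers: finitely supported maps from
  monomials to coefficients, a monomial being a finitely supported map from variables to exponents.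
\<close>

type_synonym int_mpoly = "(nat \<Rightarrow>\<^sub>0 nat) \<Rightarrow>\<^sub>0 int"

definition mpoly_vars :: "int_mpoly \<Rightarrow> nat set" where
  "mpoly_vars W = (\<Union>t \<in> Poly_Mapping.keys W. Poly_Mapping.keys t)"

definition mpoly_eval :: "int_mpoly \<Rightarrow> (nat \<Rightarrow> int) \<Rightarrow> int" where
  "mpoly_eval W x =
    (\<Sum>t \<in> Poly_Mapping.keys W. Poly_Mapping.lookup W t *
      (\<Prod>i \<in> Poly_Mapping.keys t. x i ^ Poly_Mapping.lookup t i))"

text \<open>The variables \<open>0, \<dots>, n - 1\<close> are the parameters and \<open>n, \<dots>, n + m - 1\<close> the unknowns.\<close>

definition finite_fold_representation :: "nat \<Rightarrow> nat list set \<Rightarrow> nat \<Rightarrow> int_mpoly \<Rightarrow> bool" where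
  "finite_fold_representation n M m W \<longleftrightarrow>
     mpoly_vars W \<subseteq> {..<n + m} \<and>
     (\<forall>as. length as = n \<longrightarrow>
        (as \<in> M \<longleftrightarrow>
          (\<exists>xs. length xs = m \<and> mpoly_eval W (\<lambda>i. int ((as @ xs) ! i)) = 0))) \<and>
     (\<forall>as. length as = n \<longrightarrow>
        finite {xs :: nat list. length xs = m \<and> mpoly_eval W (\<lambda>i. int ((as @ xs) ! i)) = 0})"

definition matiyasevich_conjecture :: bool where
  "matiyasevich_conjecture \<longleftrightarrow>
     (\<forall>n\<ge>1. \<forall>M. recursively_enumerable n M \<longrightarrow>
        (\<exists>m W. finite_fold_representation n M m W))"

text \<open>The formal equations \<open>x\<^sub>i = 1\<close>, \<open>x\<^sub>i + x\<^sub>j = x\<^sub>k\<close> and \<open>x\<^sub>i \<cdot> x\<^sub>j = x\<^sub>k\<close>.\<close>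

datatype equation =
    EqOne nat
  | EqAdd nat nat nat
  | EqMul nat nat nat

definition E :: "nat \<Rightarrow> equation set" where
  "E n = {EqOne i | i. i \<in> {1..n}}
     \<union> {EqAdd i j k | i j k. i \<in> {1..n} \<and> j \<in> {1..n} \<and> k \<in> {1..n}}
     \<union> {EqMul i j k | i j k. i \<in> {1..n} \<and> j \<in> {1..n} \<and> k \<in> {1..n}}"

fun satisfies :: "(nat \<Rightarrow> int) \<Rightarrow> equation \<Rightarrow> bool" where
  "satisfies x (EqOne i) \<longleftrightarrow> x i = 1"
| "satisfies x (EqAdd i j k) \<longleftrightarrow> x i + x j = x k"
| "satisfies x (EqMul i j k) \<longleftrightarrow> x i * x j = x k"

text \<open>
  Integer \<open>n\<close>-tuples are extensional functions on \<open>{1..n}\<close>, so that distinct elements of the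
  solution set are distinct tuples and its finiteness has the intended meaning.
\<close>

definition solutions :: "nat \<Rightarrow> equation set \<Rightarrow> (nat \<Rightarrow> int) set" where
  "solutions n S = {x \<in> {1..n} \<rightarrow>\<^sub>E UNIV. \<forall>e\<in>S. satisfies x e}"

end

theory Submission
  imports Defs "HOL-Computational_Algebra.Primes"
begin

text \<open>
  Fix a program \<open>p\<close> for \<open>f\<close>.  Its graph is recursively enumerable, so the conjecture supplies a
  polynomial \<open>W\<close> such that \<open>W(n, b, \<dots>)\<close> has a zero in the natural numbers only for \<open>b = f n\<close>, and
  then only finitely many.  Three obstacles separate \<open>W = 0\<close> from a system of the required form.

  \<^item> The unknowns of a system range over the integers, not over the naturals.  Lagrange's
    theorem (\<open>lagrange_four_squares\<close>) removes this: \<open>b\<close> and every unknown of \<open>W\<close> become sums of four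
    integer squares.  This keeps finiteness, because a number is a sum of four squares in only
    finitely many ways.  The equation \<open>x\<^sub>1 = b + 1\<close> is added to the polynomial as a further square
    (\<open>zeros_of_square_poly\<close>).

  \<^item> A polynomial equation has to be broken into additions and multiplications.  Evaluating the
    polynomial step by step gives each intermediate value a fresh variable, whose defining equation
    determines it uniquely; the number of solutions is therefore unchanged
    (\<open>system_for_representable_zeros\<close>).  The result is one system in a fixed number \<open>r\<close> of variables,
    independent of \<open>n\<close>, in which \<open>x\<^sub>2\<close> plays the role of the argument \<open>n\<close>.

  \<^item> Finally \<open>x\<^sub>2 = n\<close> must be enforced using exactly \<open>n\<close> variables.  The \<open>n - r\<close> variables
    left over are made to count \<open>1, 2, \<dots>, n - r\<close>.  As soon as \<open>n \<ge> 2 * r\<close>, the number \<open>r\<close> is itself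
    one of the values counted, and \<open>n = (n - r) + r\<close> is a single addition
    (\<open>system_fixing_second_variable\<close>).  So \<open>2 * r\<close> serves as the bound \<open>m(f)\<close>.
\<close>

section \<open>Sums of four squares\<close>

definition sum_four_squares :: "int \<Rightarrow> bool" where
  "sum_four_squares n \<longleftrightarrow> (\<exists>a b c d. n = a\<^sup>2 + b\<^sup>2 + c\<^sup>2 + d\<^sup>2)"

lemma euler_identity:
  fixes a b c d x y z w :: int
  shows "(a\<^sup>2 + b\<^sup>2 + c\<^sup>2 + d\<^sup>2) * (x\<^sup>2 + y\<^sup>2 + z\<^sup>2 + w\<^sup>2) =
    (a*x + b*y + c*z + d*w)\<^sup>2 + (a*y - b*x + c*w - d*z)\<^sup>2 + (a*z - c*x + d*y - b*w)\<^sup>2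
    + (a*w - d*x + b*z - c*y)\<^sup>2"
  by algebra

lemma sum_four_squares_mult:
  "sum_four_squares m \<Longrightarrow> sum_four_squares n \<Longrightarrow> sum_four_squares (m * n)"
  unfolding sum_four_squares_def using euler_identity by metis

text \<open>
  The square roots of a residue modulo a prime differ at most in sign, and a range of numbers below
  half the prime contains only one of each pair of opposite residues.
\<close>

lemma square_mod_inj:
  fixes a b p :: int
  assumes p: "prime p" and "0 \<le> a" "0 \<le> b" "2 * a < p" "2 * b < p" "p dvd a\<^sup>2 - b\<^sup>2"
  shows "a = b"
proof -
  have "a\<^sup>2 - b\<^sup>2 = (a - b) * (a + b)" by algebra
  then have "p dvd a - b \<or> p dvd a + b" using assms by (metis prime_dvd_mult_iff)
  then show ?thesis
  proof
    assume "p dvd a - b"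
    then have "a - b = 0" using zdvd_imp_le[of p "\<bar>a - b\<bar>"] assms by fastforce
    then show ?thesis by simp
  next
    assume "p dvd a + b"
    then have "a + b = 0" using zdvd_imp_le[of p "a + b"] assms by fastforce
    then show ?thesis using assms by simp
  qed
qed

text \<open>
  Pigeonhole principle: among the residues modulo \<open>p = 2 * h + 1\<close>, the \<open>h + 1\<close> squares \<open>a\<^sup>2\<close> and the
  \<open>h + 1\<close> numbers \<open>- 1 - b\<^sup>2\<close> cannot all be different.
\<close>

lemma prime_dvd_two_squares_plus_one:
  fixes p :: int
  assumes p: "prime p" and odd: "odd p"
  obtains a b where "0 \<le> a" "0 \<le> b" "2 * a < p" "2 * b < p" "p dvd a\<^sup>2 + b\<^sup>2 + 1"
proof -
  obtain h where h: "p = 2 * h + 1" using odd oddE by blast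
  have pos: "p > 0" "h \<ge> 0" using p h prime_gt_0_int[of p] by auto
  let ?I = "{0..h}"
  let ?A = "(\<lambda>a. a\<^sup>2 mod p) ` ?I" and ?B = "(\<lambda>b. (- 1 - b\<^sup>2) mod p) ` ?I"
  have injA: "inj_on (\<lambda>a. a\<^sup>2 mod p) ?I"
    by (rule inj_onI) (use square_mod_inj[OF p] h in \<open>auto simp: mod_eq_dvd_iff\<close>)
  have injB: "inj_on (\<lambda>b. (- 1 - b\<^sup>2) mod p) ?I"
  proof (rule inj_onI)
    fix a b assume ab: "a \<in> ?I" "b \<in> ?I" "(- 1 - a\<^sup>2) mod p = (- 1 - b\<^sup>2) mod p"
    then have "p dvd b\<^sup>2 - a\<^sup>2" by (simp add: mod_eq_dvd_iff)
    then show "a = b" using square_mod_inj[OF p, of b a] ab h by auto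
  qed
  have "?A \<inter> ?B \<noteq> {}"
  proof
    assume "?A \<inter> ?B = {}"
    then have "card (?A \<union> ?B) = card ?A + card ?B" by (intro card_Un_disjoint) auto
    also have "\<dots> = 2 * card ?I" using injA injB by (simp add: card_image)
    also have "\<dots> = nat (p + 1)" using h pos by simp
    finally have "card (?A \<union> ?B) = nat (p + 1)" .
    moreover have "card (?A \<union> ?B) \<le> card {0..<p}"
      by (rule card_mono) (use pos in auto)
    ultimately show False using pos by simp
  qed
  then obtain a b where ab: "a \<in> ?I" "b \<in> ?I" "a\<^sup>2 mod p = (- 1 - b\<^sup>2) mod p"
    by blast
  from ab(3) have "p dvd a\<^sup>2 + b\<^sup>2 + 1" by (simp add: mod_eq_dvd_iff algebra_simps)
  then show thesis using that[of a b] ab h by auto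
qed

lemma centred_residue:
  fixes x m :: int
  assumes "m > 0"
  obtains y k where "x = y + m * k" "4 * y\<^sup>2 \<le> m\<^sup>2"
proof -
  define y where "y = (if 2 * (x mod m) \<le> m then x mod m else x mod m - m)"
  have r: "0 \<le> x mod m" "x mod m < m" using assms by auto
  have "\<bar>2 * y\<bar> \<le> \<bar>m\<bar>" using r by (auto simp: y_def)
  then have "(2 * y)\<^sup>2 \<le> m\<^sup>2" by (rule abs_le_square_iff[THEN iffD1])
  then have "4 * y\<^sup>2 \<le> m\<^sup>2" by (simp add: power_mult_distrib)
  moreover have "\<exists>k. x = y + m * k"
  proof (cases "2 * (x mod m) \<le> m")
    case True
    then show ?thesis by (intro exI[of _ "x div m"]) (simp add: y_def)
  next
    case False
    then show ?thesis
      by (intro exI[of _ "x div m + 1"]) (simp add: y_def algebra_simps)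
  qed
  ultimately show thesis using that by blast
qed

text \<open>
  The boundary case of the residues centred at zero: if \<open>y\<close> is \<open>m / 2\<close> up to sign, the mixed term
  \<open>2 * m * k * y\<close> of \<open>(y + m * k)\<^sup>2\<close> becomes divisible by \<open>m\<^sup>2\<close>.
\<close>

lemma square_congruence_at_half:
  fixes x y m k :: int
  assumes "x = y + m * k" "4 * y\<^sup>2 = m\<^sup>2"
  shows "m\<^sup>2 dvd x\<^sup>2 - y\<^sup>2"
proof -
  have "(2 * y)\<^sup>2 = m\<^sup>2" using assms by (simp add: power_mult_distrib)
  then have "2 * y = m \<or> 2 * y = - m" by (simp only: power2_eq_iff)
  moreover have "x\<^sup>2 - y\<^sup>2 = m * k * (2 * y) + m\<^sup>2 * k\<^sup>2" using assms(1) by algebra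
  ultimately have "x\<^sup>2 - y\<^sup>2 = m\<^sup>2 * (k\<^sup>2 + k) \<or> x\<^sup>2 - y\<^sup>2 = m\<^sup>2 * (k\<^sup>2 - k)"
    by (auto simp: power2_eq_square algebra_simps)
  then show ?thesis by auto
qed

text \<open>
  The descent step.  Replacing the four roots for \<open>m * p\<close> by their centred residues modulo \<open>m\<close> gives a
  multiple \<open>m * r\<close> with \<open>r \<le> m\<close>.  In Euler's identity for the product of the two sums all four new
  roots are divisible by \<open>m\<close>, so \<open>m\<^sup>2\<close> can be cancelled.  In both extreme cases, \<open>r = 0\<close> and \<open>r = m\<close>,
  the number \<open>m * p\<close> would be divisible by \<open>m\<^sup>2\<close>, which is impossible for a prime \<open>p > m > 1\<close>.
\<close>

lemma sum_four_squares_descent: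
  fixes m p :: int
  assumes p: "prime p" and m: "1 < m" "m < p" and s: "sum_four_squares (m * p)"
  obtains r where "0 < r" "r < m" "sum_four_squares (r * p)"
proof -
  obtain a b c d where x: "m * p = a\<^sup>2 + b\<^sup>2 + c\<^sup>2 + d\<^sup>2"
    using s unfolding sum_four_squares_def by blast
  have m0: "m > 0" using m by simp
  obtain a' ka where a: "a = a' + m * ka" "4 * a'\<^sup>2 \<le> m\<^sup>2" using centred_residue[OF m0] by blast
  obtain b' kb where b: "b = b' + m * kb" "4 * b'\<^sup>2 \<le> m\<^sup>2" using centred_residue[OF m0] by blast
  obtain c' kc where c: "c = c' + m * kc" "4 * c'\<^sup>2 \<le> m\<^sup>2" using centred_residue[OF m0] by blast
  obtain d' kd where d: "d = d' + m * kd" "4 * d'\<^sup>2 \<le> m\<^sup>2" using centred_residue[OF m0] by blast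
  \<comment> \<open>The value of \<open>r\<close> comes from solving \<open>m * r = a'\<^sup>2 + b'\<^sup>2 + c'\<^sup>2 + d'\<^sup>2\<close>, with \<open>a' = a - m * ka\<close> and so on.\<close>
  define r where "r = p - 2 * (a' * ka + b' * kb + c' * kc + d' * kd)
    - m * (ka\<^sup>2 + kb\<^sup>2 + kc\<^sup>2 + kd\<^sup>2)"
  have r: "m * r = a'\<^sup>2 + b'\<^sup>2 + c'\<^sup>2 + d'\<^sup>2"
    using x a(1) b(1) c(1) d(1) unfolding r_def by algebra
  have not_sq: "\<not> m\<^sup>2 dvd m * p"
  proof
    assume "m\<^sup>2 dvd m * p"
    then have "m dvd p" using m0 by (simp add: power2_eq_square)
    then have "m = 1 \<or> m = p" using p m0 by (auto simp: prime_int_iff)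
    then show False using m by simp
  qed
  have "m * r \<le> m * m" using r a(2) b(2) c(2) d(2) by (simp add: power2_eq_square)
  then have "r \<le> m" using m0 by simp
  moreover have "r \<noteq> m"
  proof
    assume "r = m"
    then have "a'\<^sup>2 + b'\<^sup>2 + c'\<^sup>2 + d'\<^sup>2 = m\<^sup>2" using r by (simp add: power2_eq_square)
    then have "4 * a'\<^sup>2 = m\<^sup>2" "4 * b'\<^sup>2 = m\<^sup>2" "4 * c'\<^sup>2 = m\<^sup>2" "4 * d'\<^sup>2 = m\<^sup>2"
      using a(2) b(2) c(2) d(2) by auto
    then have "m\<^sup>2 dvd (a\<^sup>2 - a'\<^sup>2) + (b\<^sup>2 - b'\<^sup>2) + (c\<^sup>2 - c'\<^sup>2) + (d\<^sup>2 - d'\<^sup>2)"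
      using a(1) b(1) c(1) d(1) by (intro dvd_add square_congruence_at_half)
    also have "\<dots> = m * p - m\<^sup>2" using x \<open>a'\<^sup>2 + b'\<^sup>2 + c'\<^sup>2 + d'\<^sup>2 = m\<^sup>2\<close> by simp
    finally have "m\<^sup>2 dvd m * p" using dvd_add[of "m\<^sup>2" "m * p - m\<^sup>2" "m\<^sup>2"] by simp
    then show False using not_sq by simp
  qed
  moreover have "r > 0"
  proof (rule ccontr)
    assume "\<not> r > 0"
    then have "m * r \<le> 0" using m0 by (simp add: mult_le_0_iff)
    moreover have "0 \<le> a'\<^sup>2" "0 \<le> b'\<^sup>2" "0 \<le> c'\<^sup>2" "0 \<le> d'\<^sup>2" by auto
    ultimately have "a'\<^sup>2 = 0" "b'\<^sup>2 = 0" "c'\<^sup>2 = 0" "d'\<^sup>2 = 0" using r by linarith+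
    then have "m * p = m\<^sup>2 * (ka\<^sup>2 + kb\<^sup>2 + kc\<^sup>2 + kd\<^sup>2)"
      using x a(1) b(1) c(1) d(1) by (simp add: power_mult_distrib distrib_left)
    then show False using not_sq by simp
  qed
  moreover have "sum_four_squares (r * p)"
  proof -
    have "m\<^sup>2 * (r * p) = (a\<^sup>2 + b\<^sup>2 + c\<^sup>2 + d\<^sup>2) * (a'\<^sup>2 + b'\<^sup>2 + c'\<^sup>2 + d'\<^sup>2)"
      using x r by algebra
    also have "\<dots> = (a*a' + b*b' + c*c' + d*d')\<^sup>2 + (a*b' - b*a' + c*d' - d*c')\<^sup>2
        + (a*c' - c*a' + d*b' - b*d')\<^sup>2 + (a*d' - d*a' + b*c' - c*b')\<^sup>2"
      by (rule euler_identity)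
    also have "a*a' + b*b' + c*c' + d*d' = m * (r + ka*a' + kb*b' + kc*c' + kd*d')"
      using r a(1) b(1) c(1) d(1) by algebra
    also have "a*b' - b*a' + c*d' - d*c' = m * (ka*b' - kb*a' + kc*d' - kd*c')"
      using a(1) b(1) c(1) d(1) by algebra
    also have "a*c' - c*a' + d*b' - b*d' = m * (ka*c' - kc*a' + kd*b' - kb*d')"
      using a(1) b(1) c(1) d(1) by algebra
    also have "a*d' - d*a' + b*c' - c*b' = m * (ka*d' - kd*a' + kb*c' - kc*b')"
      using a(1) b(1) c(1) d(1) by algebra
    finally have "m\<^sup>2 * (r * p) = m\<^sup>2 * ((r + ka*a' + kb*b' + kc*c' + kd*d')\<^sup>2
        + (ka*b' - kb*a' + kc*d' - kd*c')\<^sup>2 + (ka*c' - kc*a' + kd*b' - kb*d')\<^sup>2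
        + (ka*d' - kd*a' + kb*c' - kc*b')\<^sup>2)"
      by algebra
    then have "r * p = (r + ka*a' + kb*b' + kc*c' + kd*d')\<^sup>2
        + (ka*b' - kb*a' + kc*d' - kd*c')\<^sup>2 + (ka*c' - kc*a' + kd*b' - kb*d')\<^sup>2
        + (ka*d' - kd*a' + kb*c' - kc*b')\<^sup>2"
      using m0 by (subst (asm) mult_left_cancel) auto
    then show ?thesis unfolding sum_four_squares_def by blast
  qed
  ultimately show thesis using that[of r] by simp
qed

text \<open>
  Some multiple \<open>m * p\<close> with \<open>0 < m < p\<close> is a sum of four squares, one of them \<open>1\<close> and another
  \<open>0\<close>; the descent lowers \<open>m\<close> to \<open>1\<close>.
\<close>

lemma prime_sum_four_squares:
  fixes p :: int
  assumes p: "prime p"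
  shows "sum_four_squares p"
proof (cases "p = 2")
  case True
  then have "p = 1\<^sup>2 + 1\<^sup>2 + 0\<^sup>2 + 0\<^sup>2" by simp
  then show ?thesis unfolding sum_four_squares_def by blast
next
  case False
  then have odd: "odd p" using p prime_odd_int[of p] prime_ge_2_int[of p] by force
  have pos: "p > 0" using p prime_gt_0_int by blast
  have reach: "sum_four_squares p" if "0 < m" "int m < p" "sum_four_squares (int m * p)" for m :: nat
    using that
  proof (induction m rule: less_induct)
    case (less m)
    show ?case
    proof (cases "m = 1")
      case True
      then show ?thesis using less.prems by simp
    next
      case False
      then obtain r where "0 < r" "r < int m" "sum_four_squares (r * p)"
        using sum_four_squares_descent[OF p, of "int m"] less.prems by auto
      then show ?thesis using less.IH[of "nat r"] less.prems by auto
    qed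
  qed
  obtain a b where ab: "0 \<le> a" "0 \<le> b" "2 * a < p" "2 * b < p" "p dvd a\<^sup>2 + b\<^sup>2 + 1"
    using prime_dvd_two_squares_plus_one[OF p odd] .
  from ab(5) obtain m where m: "a\<^sup>2 + b\<^sup>2 + 1 = p * m" by blast
  have "0 < p * m" using m by (metis add_nonneg_pos sum_power2_ge_zero zero_less_one)
  then have m0: "0 < m" using pos by (simp add: zero_less_mult_iff)
  have "(2 * a + 1)\<^sup>2 \<le> p\<^sup>2" "(2 * b + 1)\<^sup>2 \<le> p\<^sup>2" using ab by (auto intro: power_mono)
  then have "4 * (a\<^sup>2 + b\<^sup>2 + 1) \<le> 2 * p\<^sup>2 + 2" using ab by (simp add: power2_eq_square algebra_simps)
  moreover have "p\<^sup>2 > 1" using prime_gt_1_int[OF p] by simp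
  ultimately have "p * m < p * p" using m by (simp add: power2_eq_square)
  then have "m < p" using pos by simp
  moreover have "sum_four_squares (m * p)"
    unfolding sum_four_squares_def using m
    by (intro exI[of _ a] exI[of _ b] exI[of _ 1] exI[of _ 0]) (simp add: mult.commute)
  ultimately show ?thesis using reach[of "nat m"] m0 by simp
qed

theorem lagrange_four_squares: "sum_four_squares (int n)"
proof (induction n rule: prime_divisors_induct)
  case zero
  have "(0::int) = 0\<^sup>2 + 0\<^sup>2 + 0\<^sup>2 + 0\<^sup>2" by simp
  then show ?case unfolding sum_four_squares_def by (metis of_nat_0)
next
  case (unit x)
  have "(1::int) = 1\<^sup>2 + 0\<^sup>2 + 0\<^sup>2 + 0\<^sup>2" by simp
  then show ?case using unit unfolding sum_four_squares_def by (metis of_nat_1 nat_dvd_1_iff_1)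
next
  case (factor p x)
  then show ?case by (simp add: sum_four_squares_mult prime_sum_four_squares)
qed

section \<open>Graphs of computable functions\<close>

definition prog_pred :: recf where
  "prog_pred = Prec Zero (Proj 0)"

definition prog_add :: recf where
  "prog_add = Prec (Proj 0) (Comp Succ [Proj 1])"

text \<open>
  Truncated subtraction with the arguments exchanged: on \<open>[k, x]\<close> the value is \<open>x - k\<close>, because the
  recursion runs over the first argument.
\<close>

definition prog_rsub :: recf where
  "prog_rsub = Prec (Proj 0) (Comp prog_pred [Proj 1])"

text \<open>
  The distance of two numbers, as a sum of the two truncated differences, one of which is \<open>0\<close>.
\<close>

definition prog_dist :: recf where
  "prog_dist = Comp prog_add [Comp prog_rsub [Proj 0, Proj 1], Comp prog_rsub [Proj 1, Proj 0]]"

text \<open>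
  On arguments \<open>a, b\<close> the minimization looks for a number \<open>y\<close> at which the distance of \<open>p(a)\<close> and \<open>b\<close>
  vanishes.  That distance does not depend on \<open>y\<close>, so the search stops at once or never.
\<close>

definition prog_graph :: "recf \<Rightarrow> recf" where
  "prog_graph p = Mu (Comp prog_dist [Comp p [Proj 1], Proj 2])"

lemma computes_Proj: "i < length xs \<Longrightarrow> y = xs ! i \<Longrightarrow> computes (Proj i) xs y"
  by (auto intro: computes.proj)

lemma computes_Comp1:
  "computes g xs u \<Longrightarrow> computes f [u] z \<Longrightarrow> computes (Comp f [g]) xs z"
  by (rule computes.comp[where ys = "[u]"]) auto

lemma computes_Comp2:
  "computes g xs u \<Longrightarrow> computes h xs v \<Longrightarrow> computes f [u, v] z
    \<Longrightarrow> computes (Comp f [g, h]) xs z"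
  by (rule computes.comp[where ys = "[u, v]"]) auto

lemma computes_pred: "computes prog_pred [k] (k - 1)"
  unfolding prog_pred_def
proof (induction k)
  case 0
  show ?case by (auto intro: computes.intros)
next
  case (Suc k)
  show ?case by (rule computes.prec_Suc[OF Suc]) (simp add: computes_Proj)
qed

lemma computes_add: "computes prog_add [k, x] (k + x)"
  unfolding prog_add_def
proof (induction k)
  case 0
  show ?case by (rule computes.prec_0) (simp add: computes_Proj)
next
  case (Suc k)
  have "computes (Comp Succ [Proj 1]) [k, k + x, x] (Suc k + x)"
    by (rule computes_Comp1[of _ _ "k + x"]) (auto simp: computes_Proj intro: computes.succ)
  then show ?case by (rule computes.prec_Suc[OF Suc])
qed

lemma computes_rsub: "computes prog_rsub [k, x] (x - k)"
  unfolding prog_rsub_def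
proof (induction k)
  case 0
  show ?case by (rule computes.prec_0) (simp add: computes_Proj)
next
  case (Suc k)
  have "computes (Comp prog_pred [Proj 1]) [k, x - k, x] (x - Suc k)"
    by (rule computes_Comp1[of _ _ "x - k"]) (use computes_pred[of "x - k"] in \<open>auto simp: computes_Proj\<close>)
  then show ?case by (rule computes.prec_Suc[OF Suc])
qed

lemma computes_dist: "computes prog_dist [u, v] ((v - u) + (u - v))"
proof -
  have "computes (Comp prog_rsub [Proj 0, Proj 1]) [u, v] (v - u)"
    by (rule computes_Comp2[of _ _ u _ v]) (auto simp: computes_Proj computes_rsub)
  moreover have "computes (Comp prog_rsub [Proj 1, Proj 0]) [u, v] (u - v)"
    by (rule computes_Comp2[of _ _ v _ u]) (auto simp: computes_Proj computes_rsub)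
  ultimately show ?thesis
    unfolding prog_dist_def by (rule computes_Comp2) (rule computes_add)
qed

lemma prog_graph_halts_iff:
  "(\<exists>y. computes (prog_graph p) [a, b] y) \<longleftrightarrow> computes p [a] b"
proof
  assume p: "computes p [a] b"
  have "computes (Comp p [Proj 1]) [0, a, b] b"
    by (rule computes_Comp1[OF _ p]) (simp add: computes_Proj)
  then have "computes (Comp prog_dist [Comp p [Proj 1], Proj 2]) [0, a, b] 0"
    using computes_dist[of b b] by (intro computes_Comp2[of _ _ b _ b]) (auto simp: computes_Proj)
  then show "\<exists>y. computes (prog_graph p) [a, b] y"
    unfolding prog_graph_def by (intro exI[of _ 0] computes.mu) auto
next
  assume "\<exists>y. computes (prog_graph p) [a, b] y"
  then obtain y where "computes (Comp prog_dist [Comp p [Proj 1], Proj 2]) [y, a, b] 0"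
    unfolding prog_graph_def by (auto elim: computes_MuE)
  then obtain u where "computes p [a] u" and u: "computes prog_dist [u, b] 0"
    by (auto elim!: computes_CompE computes_ProjE simp: list_all2_Cons1)
  moreover have "u = b" using computes_deterministic[OF u computes_dist] by simp
  ultimately show "computes p [a] b" by simp
qed

lemma recursively_enumerable_graph:
  "recursively_enumerable 2 {[a, b] | a b. computes p [a] b}"
proof -
  have "as \<in> {[a, b] | a b. computes p [a] b} \<longleftrightarrow> (\<exists>y. computes (prog_graph p) as y)"
    if "length as = 2" for as
  proof -
    from that obtain a b where "as = [a, b]" by (auto simp: numeral_2_eq_2 length_Suc_conv)
    then show ?thesis by (simp add: prog_graph_halts_iff)
  qed
  then show ?thesis unfolding recursively_enumerable_def by (intro conjI exI) auto
qed

section \<open>Systems that determine fresh variables\<close>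

text \<open>
  Whatever the values \<open>x\<close> of the variables \<open>1, \<dots>, N\<close> are, the system \<open>S\<close> has exactly one extension to the
  variables \<open>N + 1, \<dots>, N'\<close> that solves it, namely \<open>y\<close>.  Existence and uniqueness are combined in one
  equivalence so that such systems can be composed.
\<close>

definition determines :: "nat \<Rightarrow> nat \<Rightarrow> equation set \<Rightarrow> bool" where
  "determines N N' S \<longleftrightarrow> N \<le> N' \<and> S \<subseteq> E N' \<and>
     (\<forall>x. \<exists>y. \<forall>z. (\<forall>i\<in>{1..N}. z i = x i) \<longrightarrow>
        ((\<forall>e\<in>S. satisfies z e) \<longleftrightarrow> (\<forall>i\<in>{N<..N'}. z i = y i)))"

lemma E_mono: "N \<le> N' \<Longrightarrow> E N \<subseteq> E N'"
  unfolding E_def by auto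

lemma satisfies_cong:
  "e \<in> E n \<Longrightarrow> (\<And>i. i \<in> {1..n} \<Longrightarrow> x i = y i) \<Longrightarrow> satisfies x e \<longleftrightarrow> satisfies y e"
  unfolding E_def by auto

lemma determinesE:
  assumes "determines N N' S"
  obtains y where "\<And>z. (\<forall>i\<in>{1..N}. z i = x i) \<Longrightarrow>
    (\<forall>e\<in>S. satisfies z e) \<longleftrightarrow> (\<forall>i\<in>{N<..N'}. z i = y i)"
proof -
  have "\<exists>y. \<forall>z. (\<forall>i\<in>{1..N}. z i = x i) \<longrightarrow>
      ((\<forall>e\<in>S. satisfies z e) \<longleftrightarrow> (\<forall>i\<in>{N<..N'}. z i = y i))"
    using assms unfolding determines_def by (elim conjE) (erule spec)
  then show thesis using that by blast
qed

lemma determines_refl: "determines N N {}"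
  unfolding determines_def by auto

lemma determines_trans:
  assumes S: "determines N N1 S" and T: "determines N1 N2 T"
  shows "determines N N2 (S \<union> T)"
  unfolding determines_def
proof (intro conjI allI)
  show "N \<le> N2" using S T unfolding determines_def by simp
  show "S \<union> T \<subseteq> E N2"
    using S T E_mono[of N1 N2] unfolding determines_def by auto
next
  fix x
  have le: "N \<le> N1" "N1 \<le> N2" using S T unfolding determines_def by auto
  obtain y1 where y1: "\<And>z. (\<forall>i\<in>{1..N}. z i = x i) \<Longrightarrow>
      (\<forall>e\<in>S. satisfies z e) \<longleftrightarrow> (\<forall>i\<in>{N<..N1}. z i = y1 i)"
    using determinesE[OF S, of x] by blast
  define x' where "x' i = (if i \<le> N then x i else y1 i)" for i
  obtain y2 where y2: "\<And>z. (\<forall>i\<in>{1..N1}. z i = x' i) \<Longrightarrow>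
      (\<forall>e\<in>T. satisfies z e) \<longleftrightarrow> (\<forall>i\<in>{N1<..N2}. z i = y2 i)"
    using determinesE[OF T, of x'] by blast
  define y where "y i = (if i \<le> N1 then y1 i else y2 i)" for i
  have "(\<forall>e\<in>S \<union> T. satisfies z e) \<longleftrightarrow> (\<forall>i\<in>{N<..N2}. z i = y i)"
    if z: "\<forall>i\<in>{1..N}. z i = x i" for z
  proof -
    have "(\<forall>i\<in>{N<..N2}. z i = y i) \<longleftrightarrow>
        (\<forall>i\<in>{N<..N1}. z i = y1 i) \<and> (\<forall>i\<in>{N1<..N2}. z i = y2 i)"
      using le unfolding y_def by (auto simp: not_le)
    moreover have "(\<forall>e\<in>T. satisfies z e) \<longleftrightarrow> (\<forall>i\<in>{N1<..N2}. z i = y2 i)"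
      if "\<forall>i\<in>{N<..N1}. z i = y1 i"
      by (rule y2) (use z that in \<open>auto simp: x'_def\<close>)
    ultimately show ?thesis using y1[OF z] by blast
  qed
  then show "\<exists>y. \<forall>z. (\<forall>i\<in>{1..N}. z i = x i) \<longrightarrow>
      ((\<forall>e\<in>S \<union> T. satisfies z e) \<longleftrightarrow> (\<forall>i\<in>{N<..N2}. z i = y i))"
    by blast
qed

lemma determines_step:
  assumes "e \<in> E (Suc N)" and e: "\<And>z. satisfies z e \<longleftrightarrow> z (Suc N) = v z"
    and cong: "\<And>z x. (\<forall>i\<in>{1..N}. z i = x i) \<Longrightarrow> v z = v x"
  shows "determines N (Suc N) {e}"
proof -
  have "(\<forall>e'\<in>{e}. satisfies z e') \<longleftrightarrow> (\<forall>i\<in>{N<..Suc N}. z i = v x)"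
    if "\<forall>i\<in>{1..N}. z i = x i" for z x
  proof -
    have "{N<..Suc N} = {Suc N}" by auto
    then show ?thesis using e[of z] cong[OF that] by simp
  qed
  then show ?thesis using assms(1) unfolding determines_def by (auto intro!: exI)
qed

text \<open>
  \<open>F\<close> can be computed from the variables \<open>1, \<dots>, K\<close> by equations in fresh variables, with result in
  variable \<open>k\<close>.  The fresh variables may be asked to start behind any \<open>N \<ge> K\<close>; this makes it possible to
  compute one function after another without any renaming of variables.
\<close>

definition representable :: "nat \<Rightarrow> ((nat \<Rightarrow> int) \<Rightarrow> int) \<Rightarrow> bool" where
  "representable K F \<longleftrightarrow> (\<forall>N\<ge>K. \<exists>N' S k. determines N N' S \<and> k \<in> {1..N'} \<and>
     (\<forall>z. (\<forall>e\<in>S. satisfies z e) \<longrightarrow> z k = F z))"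

lemma representable_var: "i \<in> {1..K} \<Longrightarrow> representable K (\<lambda>x. x i)"
  unfolding representable_def
proof (intro allI impI)
  fix N assume "i \<in> {1..K}" "K \<le> N"
  then show "\<exists>N' S k. determines N N' S \<and> k \<in> {1..N'} \<and>
      (\<forall>z. (\<forall>e\<in>S. satisfies z e) \<longrightarrow> z k = z i)"
    by (intro exI[of _ N] exI[of _ "{}"] exI[of _ i]) (auto simp: determines_refl)
qed

lemma representable_one: "representable K (\<lambda>x. 1)"
  unfolding representable_def
proof (intro allI impI)
  fix N
  have "determines N (Suc N) {EqOne (Suc N)}"
    by (rule determines_step[where v = "\<lambda>_. 1"]) (auto simp: E_def)
  then show "\<exists>N' S k. determines N N' S \<and> k \<in> {1..N'} \<and>
      (\<forall>z. (\<forall>e\<in>S. satisfies z e) \<longrightarrow> z k = 1)"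
    by (intro exI[of _ "Suc N"] exI[of _ "{EqOne (Suc N)}"]) auto
qed

text \<open>
  Compute \<open>F\<close>, then \<open>G\<close> behind the variables used for \<open>F\<close>, and combine the two results in one further
  variable.
\<close>

lemma representable_binop:
  assumes F: "representable K F" and G: "representable K G"
    and eq: "\<And>i j N. i \<in> {1..N} \<Longrightarrow> j \<in> {1..N} \<Longrightarrow>
      \<exists>e\<in>E (Suc N). \<forall>z. satisfies z e \<longleftrightarrow> z (Suc N) = op (z i) (z j)"
  shows "representable K (\<lambda>x. op (F x) (G x))"
  unfolding representable_def
proof (intro allI impI)
  fix N assume "K \<le> N"
  then obtain N1 S i where S: "determines N N1 S" "i \<in> {1..N1}"
      "\<And>z. (\<forall>e\<in>S. satisfies z e) \<Longrightarrow> z i = F z"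
    using F unfolding representable_def by meson
  have "K \<le> N1" using S(1) \<open>K \<le> N\<close> unfolding determines_def by simp
  then obtain N2 T j where T: "determines N1 N2 T" "j \<in> {1..N2}"
      "\<And>z. (\<forall>e\<in>T. satisfies z e) \<Longrightarrow> z j = G z"
    using G unfolding representable_def by meson
  have i: "i \<in> {1..N2}" using S(2) T(1) unfolding determines_def by simp
  obtain e where e: "e \<in> E (Suc N2)" "\<And>z. satisfies z e \<longleftrightarrow> z (Suc N2) = op (z i) (z j)"
    using eq[OF i T(2)] by blast
  have "determines N2 (Suc N2) {e}"
    by (rule determines_step[OF e]) (use i T(2) in auto)
  then have "determines N (Suc N2) (S \<union> (T \<union> {e}))"
    by (intro determines_trans[OF S(1)] determines_trans[OF T(1)])
  then show "\<exists>N' S k. determines N N' S \<and> k \<in> {1..N'} \<and>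
      (\<forall>z. (\<forall>e\<in>S. satisfies z e) \<longrightarrow> z k = op (F z) (G z))"
    using S(3) T(3) e(2)
    by (intro exI[of _ "Suc N2"] exI[of _ "S \<union> (T \<union> {e})"] exI[of _ "Suc N2"]) auto
qed

lemma representable_add:
  "representable K F \<Longrightarrow> representable K G \<Longrightarrow> representable K (\<lambda>x. F x + G x)"
proof (rule representable_binop[where op = "(+)"])
  fix i j N :: nat assume "i \<in> {1..N}" "j \<in> {1..N}"
  then show "\<exists>e\<in>E (Suc N). \<forall>z. satisfies z e \<longleftrightarrow> z (Suc N) = z i + z j"
    by (intro bexI[of _ "EqAdd i j (Suc N)"]) (auto simp: E_def)
qed

lemma representable_mult:
  "representable K F \<Longrightarrow> representable K G \<Longrightarrow> representable K (\<lambda>x. F x * G x)"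
proof (rule representable_binop[where op = "(*)"])
  fix i j N :: nat assume "i \<in> {1..N}" "j \<in> {1..N}"
  then show "\<exists>e\<in>E (Suc N). \<forall>z. satisfies z e \<longleftrightarrow> z (Suc N) = z i * z j"
    by (intro bexI[of _ "EqMul i j (Suc N)"]) (auto simp: E_def)
qed

text \<open>
  There is no equation for subtraction, but \<open>u = v - w\<close> is the addition \<open>u + w = v\<close>.
\<close>

lemma representable_diff:
  "representable K F \<Longrightarrow> representable K G \<Longrightarrow> representable K (\<lambda>x. F x - G x)"
proof (rule representable_binop[where op = "(-)"])
  fix i j N :: nat assume "i \<in> {1..N}" "j \<in> {1..N}"
  then show "\<exists>e\<in>E (Suc N). \<forall>z. satisfies z e \<longleftrightarrow> z (Suc N) = z i - z j"
    by (intro bexI[of _ "EqAdd (Suc N) j i"]) (auto simp: E_def)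
qed

lemma representable_zero: "representable K (\<lambda>x. 0)"
  using representable_diff[OF representable_one representable_one, of K] by simp

lemma representable_const: "representable K (\<lambda>x. c)"
proof (induction c rule: int_induct[where k = 0])
  case base
  show ?case by (rule representable_zero)
next
  case (step1 i)
  then show ?case using representable_add[OF _ representable_one] by blast
next
  case (step2 i)
  then show ?case using representable_diff[OF _ representable_one] by blast
qed

lemma representable_power: "representable K F \<Longrightarrow> representable K (\<lambda>x. F x ^ k)"
  by (induction k) (auto intro: representable_one representable_mult)

lemma representable_sum:
  "(\<And>a. a \<in> A \<Longrightarrow> representable K (F a)) \<Longrightarrow> representable K (\<lambda>x. \<Sum>a\<in>A. F a x)"
  by (induction A rule: infinite_finite_induct) (auto intro: representable_zero representable_add)

lemma representable_prod:
  "(\<And>a. a \<in> A \<Longrightarrow> representable K (F a)) \<Longrightarrow> representable K (\<lambda>x. \<Prod>a\<in>A. F a x)"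
  by (induction A rule: infinite_finite_induct) (auto intro: representable_one representable_mult)

lemma representable_mpoly_eval:
  assumes "\<And>i. i \<in> mpoly_vars W \<Longrightarrow> representable K (\<lambda>x. G x i)"
  shows "representable K (\<lambda>x. mpoly_eval W (G x))"
  unfolding mpoly_eval_def
  by (intro representable_sum representable_mult representable_const representable_prod
      representable_power assms) (auto simp: mpoly_vars_def)

lemma mpoly_eval_cong:
  "(\<And>i. i \<in> mpoly_vars W \<Longrightarrow> x i = y i) \<Longrightarrow> mpoly_eval W x = mpoly_eval W y"
  unfolding mpoly_eval_def mpoly_vars_def
  by (intro sum.cong prod.cong arg_cong2[where f = "(*)"] arg_cong2[where f = "(^)"]) auto

text \<open>
  Since the fresh variables are determined, forgetting them is a bijection from the solutions of the
  system to the zeros of \<open>Q\<close>: the system has finitely many solutions, or none, exactly if \<open>Q\<close> has so many zeros.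
\<close>

lemma system_for_representable_zeros:
  assumes Q: "representable K Q" and cong: "\<And>x y. (\<forall>i\<in>{1..K}. x i = y i) \<Longrightarrow> Q x = Q y"
  obtains r S where "K \<le> r" "S \<subseteq> E r"
    "bij_betw (\<lambda>x. restrict x {1..K}) (solutions r S) {x \<in> {1..K} \<rightarrow>\<^sub>E UNIV. Q x = 0}"
proof -
  obtain r T k where T: "determines K r T" "k \<in> {1..r}"
      "\<And>z. (\<forall>e\<in>T. satisfies z e) \<Longrightarrow> z k = Q z"
    using Q unfolding representable_def by (meson order_refl)
  have Kr: "K \<le> r" and TE: "T \<subseteq> E r" using T(1) unfolding determines_def by auto
  \<comment> \<open>The equation \<open>x\<^sub>k + x\<^sub>k = x\<^sub>k\<close> says that the result variable is zero.\<close>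
  define S where "S = insert (EqAdd k k k) T"
  have S: "S \<subseteq> E r" using TE T(2) unfolding S_def by (auto simp: E_def)
  have sol: "x \<in> solutions r S \<longleftrightarrow> x \<in> {1..r} \<rightarrow>\<^sub>E UNIV \<and> (\<forall>e\<in>T. satisfies x e) \<and> Q x = 0" for x
    using T(3)[of x] by (auto simp: solutions_def S_def)
  have "bij_betw (\<lambda>x. restrict x {1..K}) (solutions r S) {x \<in> {1..K} \<rightarrow>\<^sub>E UNIV. Q x = 0}"
  proof (rule bij_betw_imageI)
    show "inj_on (\<lambda>x. restrict x {1..K}) (solutions r S)"
    proof (rule inj_onI)
      fix x x' assume x: "x \<in> solutions r S" "x' \<in> solutions r S"
        and "restrict x {1..K} = restrict x' {1..K}"
      then have eq: "\<forall>i\<in>{1..K}. x' i = x i" by (metis restrict_apply')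
      obtain y where "\<And>z. (\<forall>i\<in>{1..K}. z i = x i) \<Longrightarrow>
          (\<forall>e\<in>T. satisfies z e) \<longleftrightarrow> (\<forall>i\<in>{K<..r}. z i = y i)"
        using determinesE[OF T(1), of x] by blast
      then have "\<forall>i\<in>{K<..r}. x i = y i" "\<forall>i\<in>{K<..r}. x' i = y i"
        using x eq unfolding sol by auto
      then have x_eq: "x i = x' i" if "i \<in> {1..r}" for i
        using eq that by (cases "i \<le> K") auto
      show "x = x'" using x x_eq unfolding solutions_def by (intro PiE_ext[of x "{1..r}" "\<lambda>_. UNIV" x']) auto
    qed
    show "(\<lambda>x. restrict x {1..K}) ` solutions r S = {x \<in> {1..K} \<rightarrow>\<^sub>E UNIV. Q x = 0}"
    proof (intro equalityI subsetI)
      fix u assume "u \<in> (\<lambda>x. restrict x {1..K}) ` solutions r S"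
      then obtain x where x: "x \<in> solutions r S" "u = restrict x {1..K}" by auto
      have "Q u = Q x" by (rule cong) (simp add: x)
      then show "u \<in> {x \<in> {1..K} \<rightarrow>\<^sub>E UNIV. Q x = 0}" using x sol by auto
    next
      fix u assume u: "u \<in> {x \<in> {1..K} \<rightarrow>\<^sub>E (UNIV :: int set). Q x = 0}"
      obtain y where y: "\<And>z. (\<forall>i\<in>{1..K}. z i = u i) \<Longrightarrow>
          (\<forall>e\<in>T. satisfies z e) \<longleftrightarrow> (\<forall>i\<in>{K<..r}. z i = y i)"
        using determinesE[OF T(1), of u] by blast
      define x where "x = restrict (\<lambda>i. if i \<le> K then u i else y i) {1..r}"
      have "\<forall>e\<in>T. satisfies x e" using Kr by (subst y) (auto simp: x_def)
      moreover have "Q x = Q u" by (rule cong) (use Kr in \<open>auto simp: x_def\<close>)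
      ultimately have "x \<in> solutions r S" using u unfolding sol by (auto simp: x_def)
      moreover have "restrict x {1..K} = u"
        using u Kr by (intro PiE_ext[of _ "{1..K}" "\<lambda>_. UNIV" u]) (auto simp: x_def)
      ultimately show "u \<in> (\<lambda>x. restrict x {1..K}) ` solutions r S" by blast
    qed
  qed
  then show thesis using that Kr S by blast
qed

section \<open>From natural unknowns to integer tuples\<close>

lemma four_square_witnesses:
  obtains q :: "nat \<Rightarrow> nat \<Rightarrow> int" where "\<And>n. (\<Sum>l<4. (q n l)\<^sup>2) = int n"
proof -
  have "\<exists>w :: nat \<Rightarrow> int. (\<Sum>l<4. (w l)\<^sup>2) = int n" for n
  proof -
    obtain a b c d where "int n = a\<^sup>2 + b\<^sup>2 + c\<^sup>2 + d\<^sup>2"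
      using lagrange_four_squares[of n] unfolding sum_four_squares_def by blast
    then show ?thesis
      by (intro exI[of _ "\<lambda>l. [a, b, c, d] ! l"]) (simp add: eval_nat_numeral)
  qed
  then show thesis using that by metis
qed

text \<open>
  Variables \<open>1\<close> and \<open>2\<close> are reserved for the result and the argument; the later ones are used in groups
  of four, each of which stands for the natural number that is the sum of its squares.
\<close>

definition square_block :: "(nat \<Rightarrow> int) \<Rightarrow> nat \<Rightarrow> int" where
  "square_block x j = (\<Sum>l<4. (x (3 + 4 * j + l))\<^sup>2)"

lemma square_block_nonneg: "0 \<le> square_block x j"
  unfolding square_block_def by (intro sum_nonneg) simp

lemma abs_le_square_block:
  assumes "l < 4"
  shows "\<bar>x (3 + 4 * j + l)\<bar> \<le> square_block x j"
proof -
  let ?a = "x (3 + 4 * j + l)"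
  have "\<bar>?a\<bar> \<le> ?a\<^sup>2" using self_le_power[of "\<bar>?a\<bar>" 2] by (cases "?a = 0") auto
  also have "\<dots> \<le> square_block x j"
    unfolding square_block_def using assms by (intro member_le_sum) auto
  finally show ?thesis .
qed

text \<open>
  The polynomial over the integers that replaces \<open>W\<close>: parameter \<open>0\<close> of \<open>W\<close> is the argument \<open>x\<^sub>2\<close>,
  parameter \<open>1\<close> is block \<open>0\<close>, and the unknowns are the remaining blocks.  The second summand couples
  the result variable \<open>x\<^sub>1\<close> to block \<open>0\<close>; being a square, it must vanish separately.
\<close>

definition square_poly :: "int_mpoly \<Rightarrow> (nat \<Rightarrow> int) \<Rightarrow> int" where
  "square_poly W x = (mpoly_eval W (\<lambda>i. if i = 0 then x 2 else square_block x (i - 1)))\<^sup>2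
     + (x 1 - 1 - square_block x 0)\<^sup>2"

lemma square_poly_eq_0_iff:
  "square_poly W x = 0 \<longleftrightarrow>
     mpoly_eval W (\<lambda>i. if i = 0 then x 2 else square_block x (i - 1)) = 0 \<and> x 1 = square_block x 0 + 1"
  unfolding square_poly_def by (auto simp: sum_power2_eq_zero_iff)

text \<open>
  With \<open>m\<close> unknowns there are \<open>m + 1\<close> blocks of four variables behind the first two, hence
  \<open>6 + 4 * m\<close> variables in total.
\<close>

lemma representable_square_block:
  assumes "j \<le> m"
  shows "representable (6 + 4 * m) (\<lambda>x. square_block x j)"
  unfolding square_block_def
  by (intro representable_sum representable_power representable_var) (use assms in auto)

lemma representable_square_poly:
  assumes "mpoly_vars W \<subseteq> {..<2 + m}"
  shows "representable (6 + 4 * m) (square_poly W)"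
proof -
  have "representable (6 + 4 * m) (\<lambda>x. mpoly_eval W (\<lambda>i. if i = 0 then x 2 else square_block x (i - 1)))"
  proof (rule representable_mpoly_eval)
    fix i assume "i \<in> mpoly_vars W"
    then have "i - 1 \<le> m" using assms by auto
    then show "representable (6 + 4 * m) (\<lambda>x. if i = 0 then x 2 else square_block x (i - 1))"
      using representable_square_block[of "i - 1" m] by (cases "i = 0") (auto intro: representable_var)
  qed
  then show ?thesis
    unfolding square_poly_def
    by (intro representable_add representable_diff representable_power representable_one
        representable_var representable_square_block) auto
qed

lemma square_poly_cong:
  assumes W: "mpoly_vars W \<subseteq> {..<2 + m}" and eq: "\<forall>i\<in>{1..6 + 4 * m}. x i = y i"
  shows "square_poly W x = square_poly W y"
proof -
  have block: "square_block x j = square_block y j" if "j \<le> m" for j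
    unfolding square_block_def by (intro sum.cong) (use eq that in auto)
  have "mpoly_eval W (\<lambda>i. if i = 0 then x 2 else square_block x (i - 1)) =
      mpoly_eval W (\<lambda>i. if i = 0 then y 2 else square_block y (i - 1))"
    by (rule mpoly_eval_cong) (use W eq block in auto)
  then show ?thesis using block[of 0] eq by (simp add: square_poly_def)
qed

text \<open>
  The blocks of a zero form a natural zero of \<open>W\<close>, so block \<open>0\<close> is \<open>f n\<close> and the other blocks are one of
  finitely many tuples.  Their entries bound all blocks, and a block bounds its variables.
  Conversely, Lagrange's theorem turns a natural zero of \<open>W\<close> into integer values for the blocks.
\<close>

lemma zeros_of_square_poly:
  fixes f :: "nat \<Rightarrow> nat"
  assumes rep: "finite_fold_representation 2 M m W"
    and M: "\<And>b. [n, b] \<in> M \<longleftrightarrow> b = f n"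
  defines "Z \<equiv> {x \<in> {1..6 + 4 * m} \<rightarrow>\<^sub>E UNIV. square_poly W x = 0 \<and> x 2 = int n}"
  shows "finite Z" and "Z \<noteq> {}" and "\<And>x. x \<in> Z \<Longrightarrow> x 1 = int (f n) + 1"
proof -
  have vars: "mpoly_vars W \<subseteq> {..<2 + m}"
    and mem: "\<And>b. [n, b] \<in> M \<longleftrightarrow>
      (\<exists>xs. length xs = m \<and> mpoly_eval W (\<lambda>i. int (([n, b] @ xs) ! i)) = 0)"
    and fin: "\<And>b. finite {xs. length xs = m \<and> mpoly_eval W (\<lambda>i. int (([n, b] @ xs) ! i)) = 0}"
    using rep[unfolded finite_fold_representation_def]
    by (simp_all del: append.simps append_Cons)
  define X where "X = {xs. length xs = m \<and> mpoly_eval W (\<lambda>i. int (([n, f n] @ xs) ! i)) = 0}"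
  define blocks where "blocks x = map (\<lambda>j. nat (square_block x (Suc j))) [0..<m]" for x
  have eval: "mpoly_eval W (\<lambda>i. if i = 0 then x 2 else square_block x (i - 1)) =
      mpoly_eval W (\<lambda>i. int (([n, b] @ xs) ! i))"
    if "x 2 = int n" "square_block x 0 = int b" "length xs = m"
      "\<And>j. j < m \<Longrightarrow> square_block x (Suc j) = int (xs ! j)" for x b xs
  proof (rule mpoly_eval_cong)
    fix i assume "i \<in> mpoly_vars W"
    then have "i < 2 + m" using vars by auto
    then consider "i = 0" | "i = 1" | j where "i = Suc (Suc j)" "j < m"
      by (metis One_nat_def Suc_less_eq add_2_eq_Suc not0_implies_Suc)
    then show "(if i = 0 then x 2 else square_block x (i - 1)) = int (([n, b] @ xs) ! i)"
      by cases (use that in auto)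
  qed
  have zero: "square_block x 0 = int (f n) \<and> x 1 = int (f n) + 1 \<and> blocks x \<in> X" if "x \<in> Z" for x
  proof -
    have x: "x 2 = int n" "x 1 = square_block x 0 + 1"
      "mpoly_eval W (\<lambda>i. if i = 0 then x 2 else square_block x (i - 1)) = 0"
      using that by (auto simp: Z_def square_poly_eq_0_iff)
    define b where "b = nat (square_block x 0)"
    have b: "square_block x 0 = int b" by (simp add: b_def square_block_nonneg)
    have W: "mpoly_eval W (\<lambda>i. int (([n, b] @ blocks x) ! i)) = 0"
      using eval[OF x(1) b, of "blocks x"] x(3) by (simp add: blocks_def square_block_nonneg)
    then have "[n, b] \<in> M" unfolding mem by (intro exI[of _ "blocks x"]) (simp add: blocks_def)
    then have "b = f n" using M by simp
    then show ?thesis using x(2) b W by (simp add: X_def blocks_def)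
  qed
  then show "\<And>x. x \<in> Z \<Longrightarrow> x 1 = int (f n) + 1" by blast
  have finX: "finite X" unfolding X_def by (rule fin)
  \<comment> \<open>A crude common bound for the first two variables and for all blocks.\<close>
  define B where "B = int n + 1 + int (f n) + int (\<Sum>xs\<in>X. sum_list xs)"
  have B: "int n \<le> B" "int (f n) + 1 \<le> B"
    unfolding B_def using of_nat_0_le_iff[of "\<Sum>xs\<in>X. sum_list xs"] by linarith+
  have "Z \<subseteq> {1..6 + 4 * m} \<rightarrow>\<^sub>E {-B..B}"
  proof
    fix x assume xZ: "x \<in> Z"
    have block: "square_block x j \<le> B" if "j \<le> m" for j
    proof (cases j)
      case 0
      then show ?thesis using zero[OF xZ] B by simp
    next
      case (Suc j')
      then have "nat (square_block x j) \<in> set (blocks x)"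
        using that by (auto simp: blocks_def)
      then have "nat (square_block x j) \<le> sum_list (blocks x)" by (rule member_le_sum_list) simp
      also have "\<dots> \<le> (\<Sum>xs\<in>X. sum_list xs)"
        using zero[OF xZ] finX by (intro member_le_sum) auto
      finally have "square_block x j \<le> int (\<Sum>xs\<in>X. sum_list xs)" by (simp only: nat_le_iff)
      then show ?thesis unfolding B_def by linarith
    qed
    have "x i \<in> {-B..B}" if i: "i \<in> {1..6 + 4 * m}" for i
    proof -
      consider "i = 1" | "i = 2" | "3 \<le> i" using i by fastforce
      then show ?thesis
      proof cases
        case 1
        then show ?thesis using zero[OF xZ] B by simp
      next
        case 2
        then show ?thesis using xZ B by (simp add: Z_def)
      next
        case 3
        \<comment> \<open>Variable \<open>3\<close> is the first one that belongs to a block.\<close>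
        define j l where "j = (i - 3) div 4" and "l = (i - 3) mod 4"
        have "i = 3 + 4 * j + l" "l < 4" using 3 by (auto simp: j_def l_def)
        moreover have "j \<le> m" using i by (auto simp: j_def)
        ultimately have "\<bar>x i\<bar> \<le> B" using abs_le_square_block[of l x j] block[of j] by simp
        then show ?thesis by auto
      qed
    qed
    then show "x \<in> {1..6 + 4 * m} \<rightarrow>\<^sub>E {-B..B}" using xZ by (auto simp: Z_def PiE_iff)
  qed
  then show "finite Z" by (rule finite_subset) (intro finite_PiE; simp)
  obtain xs where xs: "length xs = m" "mpoly_eval W (\<lambda>i. int (([n, f n] @ xs) ! i)) = 0"
    using M[of "f n"] mem by auto
  obtain q :: "nat \<Rightarrow> nat \<Rightarrow> int" where q: "\<And>n. (\<Sum>l<4. (q n l)\<^sup>2) = int n"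
    using four_square_witnesses by blast
  \<comment> \<open>Block \<open>0\<close> represents \<open>f n\<close>, and block \<open>j + 1\<close> the unknown \<open>xs ! j\<close>.\<close>
  define x where "x = restrict (\<lambda>i. if i = 1 then int (f n) + 1 else if i = 2 then int n
    else q ((f n # xs) ! ((i - 3) div 4)) ((i - 3) mod 4)) {1..6 + 4 * m}"
  have block: "square_block x j = int ((f n # xs) ! j)" if "j \<le> m" for j
  proof -
    have "square_block x j = (\<Sum>l<4. (q ((f n # xs) ! j) l)\<^sup>2)"
      unfolding square_block_def by (intro sum.cong) (use that in \<open>auto simp: x_def\<close>)
    then show ?thesis by (simp add: q)
  qed
  have "x \<in> {1..6 + 4 * m} \<rightarrow>\<^sub>E UNIV" "x 2 = int n" "x 1 = int (f n) + 1"
    by (auto simp: x_def)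
  moreover have "mpoly_eval W (\<lambda>i. if i = 0 then x 2 else square_block x (i - 1)) = 0"
    using eval[of x "f n" xs] xs block[of 0] block[of "Suc _"] \<open>x 2 = int n\<close> by simp
  ultimately have "x \<in> Z" using block[of 0] by (simp add: Z_def square_poly_eq_0_iff)
  then show "Z \<noteq> {}" by blast
qed

text \<open>
  The additional equations are \<open>x\<^sub>i = i - r\<close> for \<open>r < i \<le> n\<close>, written as a chain of additions of
  \<open>x\<^bsub>r + 1\<^esub> = 1\<close>, and \<open>x\<^sub>n + x\<^bsub>2 * r\<^esub> = x\<^sub>2\<close>, which reads \<open>(n - r) + r = x\<^sub>2\<close>.
\<close>

lemma system_fixing_second_variable:
  assumes S: "S \<subseteq> E r" and r: "2 \<le> r" "2 * r \<le> n"
  obtains S' where "S' \<subseteq> E n"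
    "solutions n S' = (\<lambda>u. \<lambda>i\<in>{1..n}. if i \<le> r then u i else int (i - r)) ` {u \<in> solutions r S. u 2 = int n}"
proof -
  define C where "C = {EqAdd (r + i) (r + 1) (r + i + 1) | i. 1 \<le> i \<and> i < n - r}"
  define S' where "S' = S \<union> {EqOne (r + 1)} \<union> C \<union> {EqAdd n (2 * r) 2}"
  have "S \<subseteq> E n" using S E_mono[of r n] r by auto
  moreover have "EqOne (r + 1) \<in> E n" "EqAdd n (2 * r) 2 \<in> E n" "C \<subseteq> E n"
    using r unfolding C_def E_def by auto
  ultimately have "S' \<subseteq> E n" unfolding S'_def by simp
  moreover have "solutions n S' =
      (\<lambda>u. \<lambda>i\<in>{1..n}. if i \<le> r then u i else int (i - r)) ` {u \<in> solutions r S. u 2 = int n}"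
    (is "_ = ?ext ` ?U")
  proof (intro equalityI subsetI)
    fix x assume "x \<in> solutions n S'"
    then have x: "x \<in> {1..n} \<rightarrow>\<^sub>E UNIV" "\<forall>e\<in>S. satisfies x e" "x (r + 1) = 1"
      "\<forall>e\<in>C. satisfies x e" "x n + x (2 * r) = x 2"
      unfolding solutions_def S'_def by auto
    have chain: "x (r + i) = int i" if "1 \<le> i" "i \<le> n - r" for i
      using that
    proof (induction i rule: dec_induct)
      case base
      show ?case using x(3) by simp
    next
      case (step i)
      then have "EqAdd (r + i) (r + 1) (r + i + 1) \<in> C" unfolding C_def by auto
      then have "x (r + i) + x (r + 1) = x (r + i + 1)" using x(4) by fastforce
      then show ?case using step x(3) by simp
    qed
    have x2: "x 2 = int n" using x(5) chain[of "n - r"] chain[of r] r by (simp add: mult_2)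
    define u where "u = restrict x {1..r}"
    have "satisfies u e" if "e \<in> S" for e
      using satisfies_cong[of e r u x] S that x(2) by (auto simp: u_def)
    then have "u \<in> ?U" using r x2 by (auto simp: solutions_def u_def)
    moreover have "x = ?ext u"
    proof
      fix i
      show "x i = ?ext u i"
      proof (cases "i \<in> {1..n}")
        case True
        then show ?thesis using chain[of "i - r"] by (auto simp: u_def)
      next
        case False
        then show ?thesis using x(1) by (auto simp: PiE_def extensional_def)
      qed
    qed
    ultimately show "x \<in> ?ext ` ?U" by blast
  next
    fix x assume "x \<in> ?ext ` ?U"
    then obtain u where u: "u \<in> solutions r S" "u 2 = int n" "x = ?ext u" by auto
    have "satisfies x e" if "e \<in> S" for e
      using satisfies_cong[of e r x u] S that u r by (auto simp: solutions_def)
    moreover have "satisfies x e" if "e \<in> C" for e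
      using that r unfolding C_def u(3) by auto
    moreover have "x n + x (2 * r) = x 2" "x (r + 1) = 1" "x \<in> {1..n} \<rightarrow>\<^sub>E UNIV"
      using r u(2) unfolding u(3) by auto
    ultimately show "x \<in> solutions n S'" unfolding solutions_def S'_def by auto
  qed
  ultimately show thesis using that by blast
qed

theorem theorem8:
  assumes "matiyasevich_conjecture"
  shows "\<forall>f :: nat \<Rightarrow> nat. computable_pos f \<longrightarrow>
    (\<exists>m :: nat. m > 0 \<and> (\<forall>n\<ge>m. \<exists>S. S \<subseteq> E n
        \<and> finite (solutions n S)
        \<and> solutions n S \<noteq> {}
        \<and> (\<forall>x \<in> solutions n S. x 1 = int (f n) + 1)))"
proof (intro allI impI)
  fix f :: "nat \<Rightarrow> nat"
  assume "computable_pos f"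
  then obtain p where p: "\<And>n. 1 \<le> n \<Longrightarrow> computes p [n] (f n)"
    unfolding computable_pos_def by blast
  define M where "M = {[a, b] | a b. computes p [a] b}"
  have M: "[n, b] \<in> M \<longleftrightarrow> b = f n" if "1 \<le> n" for n b
    using p[OF that] computes_deterministic by (auto simp: M_def)
  have "recursively_enumerable 2 M" unfolding M_def by (rule recursively_enumerable_graph)
  then have "\<exists>m W. finite_fold_representation 2 M m W"
    using assms unfolding matiyasevich_conjecture_def by simp
  then obtain m W where rep: "finite_fold_representation 2 M m W" by blast
  then have vars: "mpoly_vars W \<subseteq> {..<2 + m}" unfolding finite_fold_representation_def by simp
  let ?K = "6 + 4 * m"
  obtain r S where r: "?K \<le> r" and S: "S \<subseteq> E r"
    and bij: "bij_betw (\<lambda>x. restrict x {1..?K}) (solutions r S)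
      {x \<in> {1..?K} \<rightarrow>\<^sub>E UNIV. square_poly W x = 0}"
    using system_for_representable_zeros[OF representable_square_poly[OF vars] square_poly_cong[OF vars]]
    by blast
  have "\<exists>S'. S' \<subseteq> E n \<and> finite (solutions n S') \<and> solutions n S' \<noteq> {}
      \<and> (\<forall>x \<in> solutions n S'. x 1 = int (f n) + 1)" if n: "2 * r \<le> n" for n
  proof -
    define Z where "Z = {x \<in> {1..?K} \<rightarrow>\<^sub>E UNIV. square_poly W x = 0 \<and> x 2 = int n}"
    have "1 \<le> n" using n r by simp
    note Z = zeros_of_square_poly[where f = f and n = n, OF rep M[OF this], folded Z_def]
    define U where "U = {u \<in> solutions r S. u 2 = int n}"
    have U: "bij_betw (\<lambda>x. restrict x {1..?K}) U Z"
    proof (rule bij_betw_subset[OF bij])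
      show "U \<subseteq> solutions r S" by (auto simp: U_def)
      show "(\<lambda>x. restrict x {1..?K}) ` U = Z"
      proof (intro equalityI subsetI)
        fix z assume "z \<in> (\<lambda>x. restrict x {1..?K}) ` U"
        then show "z \<in> Z" using bij by (auto simp: U_def Z_def bij_betw_def)
      next
        fix z assume z: "z \<in> Z"
        then have "z \<in> (\<lambda>x. restrict x {1..?K}) ` solutions r S"
          using bij unfolding Z_def bij_betw_def by blast
        then obtain u where "u \<in> solutions r S" "z = restrict u {1..?K}" by blast
        then show "z \<in> (\<lambda>x. restrict x {1..?K}) ` U" using z by (auto simp: U_def Z_def)
      qed
    qed
    have "finite U" "U \<noteq> {}" using U Z(1,2) bij_betw_finite by (auto simp: bij_betw_def)
    moreover have "u 1 = int (f n) + 1" if "u \<in> U" for u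
      using Z(3)[OF bij_betwE[OF U, rule_format, OF that]] by simp
    moreover obtain S' where "S' \<subseteq> E n"
      "solutions n S' = (\<lambda>u. \<lambda>i\<in>{1..n}. if i \<le> r then u i else int (i - r)) ` U"
      using system_fixing_second_variable[OF S _ n] r unfolding U_def by auto
    ultimately show ?thesis using n r by (intro exI[of _ S']) auto
  qed
  then show "\<exists>m :: nat. m > 0 \<and> (\<forall>n\<ge>m. \<exists>S. S \<subseteq> E n
        \<and> finite (solutions n S)
        \<and> solutions n S \<noteq> {}
        \<and> (\<forall>x \<in> solutions n S. x 1 = int (f n) + 1))"
    using r by (intro exI[of _ "2 * r"]) auto
qed

end
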